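(* Consider the F-RAN system with pipelined fronthaul-edge transmission described in the context, with $n_T$ antennas at each EN. For any fractional cache size $\mu\in[0,1]$ and fronthaul rate $r\ge0$, $$\frac{\delta_{p,ach}(\mu,r)}{\delta_P^*(\mu,r)}\le 2,$$ where $\delta_P^*(\mu,r)$ is the minimum pipelined NDT and $\delta_{p,ach}(\mu,r)$ is the achievable pipelined NDT defined in the context.
   Context: F-RAN model with pipelined transmission. $K_T,K_R,n_T\ge 1$ and $N\ge K_R$ are integers; $[K]=\{1,\dots,K\}$. There are $K_T$ edge nodes (ENs) with $n_T$ antennas each, $K_R$ single-antenna users, and a cloud with a library of $N$ files $W_1,\dots,W_N$ of equal size. Each file is split into $F\ge 1$ equal packets, $\mathcal W_n=\{W_{n1},\dots,W_{nF}\}$ ($F$ is a free design parameter). $\mu\in[0,1]$ is the fractional cache size and $r\ge 0$ the fronthaul rate (each fronthaul link has capacity $r\log P$ bits per channel use, $P$ = SNR). Caching: EN $i$ stores sets $\mathcal C_{in}\subseteq\mathcal W_n$ with $|\mathcal C_{in}|\le \mu F$ for every $n$, chosen before the requests are known; $\mathcal C_i=\bigcup_n\mathcal C_{in}$. Delivery: user $k$ requests file $d_k\in[N]$; $\boldsymbol d=(d_1,\dots,d_{K_R})$. Delivery is organized in $B$ blocks. In each block $b$: (i) the cloud sends to each EN $i$ a set $\mathcal F_i(b)$ of (uncoded) packets of requested files; (ii) simultaneously, a set $\mathcal R(b)\subseteq[K_R]$ of users is served by one-shot linear precoding, each $k\in\mathcal R(b)$ with exactly one packet of $W_{d_k}$;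 the stream for user $k$ is sent with precoding vectors $\boldsymbol v_{i,k}\in\mathbb C^{n_T}$ by those ENs $i$ for which that packet lies in $\mathcal C_i\cup\bigcup_{b'<b}\mathcal F_i(b')$ (the other ENs use $\boldsymbol v_{i,k}=0$); decodability without interference means $\sum_i \boldsymbol h_{ki}^T\boldsymbol v_{i,k}\ne 0$ and $\sum_i \boldsymbol h_{k'i}^T\boldsymbol v_{i,k}=0$ for all $k'\in\mathcal R(b)\setminus\{k\}$, where $\boldsymbol h_{ki}=\boldsymbol h_{ki}(b)\in\mathbb C^{n_T}$ is the channel from EN $i$ to user $k$. After the $B$ blocks every user must have received all $F$ packets of its file. Delivery may depend on $\boldsymbol d$ and on the channels. The channels are arbitrary but non-degenerate: in each block, every square submatrix of the $K_R\times K_Tn_T$ matrix with rows $(\boldsymbol h_{k1}^T,\dots,\boldsymbol h_{kK_T}^T)$ is invertible. NDT (pipelined mode): each block lasts for the maximum of its fronthaul and edge durations, so for a policy and request $\boldsymbol d$ the normalized delivery time is $\sum_{b=1}^{B}\max\big\{\max_i|\mathcal F_i(b)|/(Fr),\,1/F\big\}$ (if $r=0$, nothing may be sent on the fronthaul and the fronthaul term is $0$); the NDT of the policy is the maximum over $\boldsymbol d$. $\bar\delta_P(\mu,r)$ is the infimum of the NDT over all $F\ge1$ and all policies ($+\infty$ if there is none), and the minimum pipelined NDT $\delta_P^*(\mu,r)$ is the lower convex envelope of $\bar\delta_P(\mu,r)$ as a function of $\mu\in[0,1]$ for fixed $r$. Achievable pipelined NDT: let $(x)^+=\max\{x,0\}$,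 $m_{max}=\min\{K_T,\lceil K_R/n_T\rceil\}$, $m_{eq}(\mu,r)=\frac{\mu K_T}{2}+\frac{\sqrt{(\mu K_Tn_T)^2+4n_TK_Tr}}{2n_T}$, and $m_p(\mu,r)=\max\{\lfloor m_{eq}(\mu,r)\rfloor,1\}$ if $\mu K_T\le m_{max}-\frac{K_Tr}{m_{max}n_T}$, $m_p(\mu,r)=m_{max}$ if $\mu K_T\ge m_{max}-\frac{K_Tr}{m_{max}n_T}$. Then $\delta_{p,ach}(\mu,r)=\max\{\frac{K_R(1-\mu K_T)}{K_Tr},1\}$ if $\mu K_T<(1-\frac{K_Tr}{n_T})^+$; and on the range $\{\mu\in[0,1]:\mu K_T\ge(1-\frac{K_Tr}{n_T})^+\}$, $\delta_{p,ach}(\mu,r)$ is the lower convex envelope (over that range, as a function of $\mu$ for fixed $r$) of $\max\{\frac{K_R}{m_p(\mu,r)n_T},1\}$. For $r=0$, a quotient with positive numerator and denominator $K_Tr$ is $+\infty$; when $\delta_P^*(\mu,r)=+\infty$ the claim is void. *)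

theory Defs
  imports
    Complex_Main
    "HOL-Library.Extended_Real"
    "HOL-Library.FuncSet"
    "Jordan_Normal_Form.DL_Submatrix"
begin

text \<open>
  Edge nodes, users, files, packets of a file and blocks are numbered from 0. A packet is a pair
  (file, position in the file).
\<close>

type_synonym packet = "nat \<times> nat"

text \<open>In a channel \<open>g\<close> the vector \<open>g k i\<close> is the channel from edge node \<open>i\<close> to user \<open>k\<close>.\<close>

type_synonym channel = "nat \<Rightarrow> nat \<Rightarrow> complex vec"

definition channel_matrix :: "nat \<Rightarrow> nat \<Rightarrow> nat \<Rightarrow> channel \<Rightarrow> complex mat" where
  "channel_matrix KT KR nT g =
     mat KR (KT * nT) (\<lambda>(k, j). g k (j div nT) $ (j mod nT))"

definition nondegenerate :: "nat \<Rightarrow> nat \<Rightarrow> nat \<Rightarrow> channel \<Rightarrow> bool" where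
  "nondegenerate KT KR nT g \<longleftrightarrow>
     (\<forall>k<KR. \<forall>i<KT. g k i \<in> carrier_vec nT) \<and>
     (\<forall>I J. I \<subseteq> {..<KR} \<and> J \<subseteq> {..<KT * nT} \<and> card I = card J \<longrightarrow>
        invertible_mat (submatrix (channel_matrix KT KR nT g) I J))"

text \<open>\<open>C i n\<close> is the set of positions of the packets of file \<open>n\<close> cached at edge node \<open>i\<close>.\<close>

type_synonym caching = "nat \<Rightarrow> nat \<Rightarrow> nat set"

definition valid_caching :: "nat \<Rightarrow> nat \<Rightarrow> real \<Rightarrow> nat \<Rightarrow> caching \<Rightarrow> bool" where
  "valid_caching KT N \<mu> F C \<longleftrightarrow>
     (\<forall>i<KT. \<forall>n<N. C i n \<subseteq> {..<F} \<and> real (card (C i n)) \<le> \<mu> * real F)"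

text \<open>
  Delivery for one request vector: number of blocks \<open>B\<close>; packets \<open>fronthaul b i\<close> sent by the cloud
  to edge node \<open>i\<close> in block \<open>b\<close>; users \<open>served b\<close>; position \<open>pkt b k\<close> of the packet (of the file
  requested by \<open>k\<close>) delivered to user \<open>k\<close>; precoding vector \<open>precoder b i k\<close> used by edge node
  \<open>i\<close> for the stream of user \<open>k\<close>.
\<close>

record delivery =
  num_blocks :: nat
  fronthaul :: "nat \<Rightarrow> nat \<Rightarrow> packet set"
  served :: "nat \<Rightarrow> nat set"
  pkt :: "nat \<Rightarrow> nat \<Rightarrow> nat"
  precoder :: "nat \<Rightarrow> nat \<Rightarrow> nat \<Rightarrow> complex vec"

text \<open>Packets edge node \<open>i\<close> can transmit in block \<open>b\<close>: what the cloud sends in block \<open>b\<close> itself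
  only becomes usable afterwards.\<close>

definition available :: "nat \<Rightarrow> caching \<Rightarrow> delivery \<Rightarrow> nat \<Rightarrow> nat \<Rightarrow> packet set" where
  "available N C D b i =
     {(n, f). n < N \<and> f \<in> C i n} \<union> (\<Union>b'<b. fronthaul D b' i)"

definition valid_fronthaul :: "nat \<Rightarrow> nat \<Rightarrow> real \<Rightarrow> nat \<Rightarrow> (nat \<Rightarrow> nat) \<Rightarrow> delivery \<Rightarrow> bool" where
  "valid_fronthaul KT KR r F d D \<longleftrightarrow>
     (\<forall>b<num_blocks D. \<forall>i<KT.
        fronthaul D b i \<subseteq> (d ` {..<KR}) \<times> {..<F} \<and> (r = 0 \<longrightarrow> fronthaul D b i = {}))"

definition valid_transmission ::
  "nat \<Rightarrow> nat \<Rightarrow> nat \<Rightarrow> nat \<Rightarrow> (nat \<Rightarrow> channel) \<Rightarrow> nat \<Rightarrow> caching \<Rightarrow> (nat \<Rightarrow> nat) \<Rightarrow> delivery \<Rightarrow> bool" where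
  "valid_transmission KT KR nT N h F C d D \<longleftrightarrow>
     (\<forall>b<num_blocks D.
        served D b \<subseteq> {..<KR} \<and>
        (\<forall>k\<in>served D b.
           pkt D b k < F \<and>
           (\<forall>i<KT. precoder D b i k \<in> carrier_vec nT \<and>
              ((d k, pkt D b k) \<notin> available N C D b i \<longrightarrow> precoder D b i k = 0\<^sub>v nT)) \<and>
           (\<Sum>i<KT. h b k i \<bullet> precoder D b i k) \<noteq> 0 \<and>
           (\<forall>k'\<in>served D b - {k}. (\<Sum>i<KT. h b k' i \<bullet> precoder D b i k) = 0)))"

definition delivers_all :: "nat \<Rightarrow> nat \<Rightarrow> delivery \<Rightarrow> bool" where
  "delivers_all KR F D \<longleftrightarrow>
     (\<forall>k<KR. \<forall>f<F. \<exists>b<num_blocks D. k \<in> served D b \<and> pkt D b k = f)"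

definition requests :: "nat \<Rightarrow> nat \<Rightarrow> (nat \<Rightarrow> nat) set" where
  "requests KR N = {..<KR} \<rightarrow>\<^sub>E {..<N}"

text \<open>A policy with \<open>F\<close> packets per file is a caching \<open>C\<close>, which does not depend on the request
  vector, together with a delivery \<open>\<D> d\<close> for every request vector \<open>d\<close>.\<close>

definition valid_policy ::
  "nat \<Rightarrow> nat \<Rightarrow> nat \<Rightarrow> nat \<Rightarrow> (nat \<Rightarrow> channel) \<Rightarrow> real \<Rightarrow> real \<Rightarrow>
   nat \<Rightarrow> caching \<Rightarrow> ((nat \<Rightarrow> nat) \<Rightarrow> delivery) \<Rightarrow> bool" where
  "valid_policy KT KR nT N h \<mu> r F C \<D> \<longleftrightarrow>
     F \<ge> 1 \<and> valid_caching KT N \<mu> F C \<and>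
     (\<forall>d\<in>requests KR N.
        valid_fronthaul KT KR r F d (\<D> d) \<and>
        valid_transmission KT KR nT N h F C d (\<D> d) \<and>
        delivers_all KR F (\<D> d))"

definition fronthaul_time :: "nat \<Rightarrow> real \<Rightarrow> nat \<Rightarrow> delivery \<Rightarrow> nat \<Rightarrow> real" where
  "fronthaul_time KT r F D b =
     (if r = 0 then 0
      else real (Max ((\<lambda>i. card (fronthaul D b i)) ` {..<KT})) / (real F * r))"

definition delivery_time :: "nat \<Rightarrow> real \<Rightarrow> nat \<Rightarrow> delivery \<Rightarrow> real" where
  "delivery_time KT r F D = (\<Sum>b<num_blocks D. max (fronthaul_time KT r F D b) (1 / real F))"

definition policy_NDT ::
  "nat \<Rightarrow> nat \<Rightarrow> nat \<Rightarrow> real \<Rightarrow> nat \<Rightarrow> ((nat \<Rightarrow> nat) \<Rightarrow> delivery) \<Rightarrow> real" where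
  "policy_NDT KT KR N r F \<D> = Max ((\<lambda>d. delivery_time KT r F (\<D> d)) ` requests KR N)"

definition delta_bar_P ::
  "nat \<Rightarrow> nat \<Rightarrow> nat \<Rightarrow> nat \<Rightarrow> (nat \<Rightarrow> channel) \<Rightarrow> real \<Rightarrow> real \<Rightarrow> ereal" where
  "delta_bar_P KT KR nT N h \<mu> r =
     Inf {ereal (policy_NDT KT KR N r F \<D>) | F C \<D>. valid_policy KT KR nT N h \<mu> r F C \<D>}"

definition ereal_convex_on :: "real set \<Rightarrow> (real \<Rightarrow> ereal) \<Rightarrow> bool" where
  "ereal_convex_on S g \<longleftrightarrow>
     (\<forall>x\<in>S. g x \<noteq> -\<infinity>) \<and>
     (\<forall>x\<in>S. \<forall>y\<in>S. \<forall>t. 0 < t \<and> t < 1 \<longrightarrow>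
        g ((1 - t) * x + t * y) \<le> ereal (1 - t) * g x + ereal t * g y)"

text \<open>The largest convex function on the interval \<open>S\<close> below \<open>f\<close>; only meaningful at points of \<open>S\<close>.
  Minorants may take the value \<open>\<infinity>\<close>, since \<open>f\<close> may.\<close>

definition lower_convex_envelope :: "real set \<Rightarrow> (real \<Rightarrow> ereal) \<Rightarrow> real \<Rightarrow> ereal" where
  "lower_convex_envelope S f x = Sup {g x | g. ereal_convex_on S g \<and> (\<forall>y\<in>S. g y \<le> f y)}"

definition delta_star_P ::
  "nat \<Rightarrow> nat \<Rightarrow> nat \<Rightarrow> nat \<Rightarrow> (nat \<Rightarrow> channel) \<Rightarrow> real \<Rightarrow> real \<Rightarrow> ereal" where
  "delta_star_P KT KR nT N h \<mu> r =
     lower_convex_envelope {0..1} (\<lambda>\<nu>. delta_bar_P KT KR nT N h \<nu> r) \<mu>"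

definition m_max :: "nat \<Rightarrow> nat \<Rightarrow> nat \<Rightarrow> int" where
  "m_max KT KR nT = min (int KT) \<lceil>real KR / real nT\<rceil>"

definition m_eq :: "nat \<Rightarrow> nat \<Rightarrow> real \<Rightarrow> real \<Rightarrow> real" where
  "m_eq KT nT \<mu> r =
     \<mu> * real KT / 2 +
     sqrt ((\<mu> * real KT * real nT)\<^sup>2 + 4 * real nT * real KT * r) / (2 * real nT)"

text \<open>In the boundary case of the condition below, \<open>m_eq\<close> equals \<open>m_max\<close>, so both branches agree.\<close>

definition m_p :: "nat \<Rightarrow> nat \<Rightarrow> nat \<Rightarrow> real \<Rightarrow> real \<Rightarrow> int" where
  "m_p KT KR nT \<mu> r =
     (if \<mu> * real KT \<le>
           real_of_int (m_max KT KR nT) - real KT * r / (real_of_int (m_max KT KR nT) * real nT)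
      then max \<lfloor>m_eq KT nT \<mu> r\<rfloor> 1
      else m_max KT KR nT)"

definition delta_p_ach :: "nat \<Rightarrow> nat \<Rightarrow> nat \<Rightarrow> real \<Rightarrow> real \<Rightarrow> ereal" where
  "delta_p_ach KT KR nT \<mu> r =
     (if \<mu> * real KT < max (1 - real KT * r / real nT) 0
      then (if r = 0 then \<infinity> else ereal (max (real KR * (1 - \<mu> * real KT) / (real KT * r)) 1))
      else lower_convex_envelope
             {\<nu>. 0 \<le> \<nu> \<and> \<nu> \<le> 1 \<and> \<nu> * real KT \<ge> max (1 - real KT * r / real nT) 0}
             (\<lambda>\<nu>. ereal (max (real KR / (real_of_int (m_p KT KR nT \<nu> r) * real nT)) 1)) \<mu>)"

end

theory Submission
  imports Defs "HOL-Analysis.Convex"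
begin

text \<open>
  Every normalized delivery time \<open>T\<close> satisfies \<open>T \<ge> 1\<close>, \<open>T \<ge> KR (1 - \<mu> KT) / (KT r)\<close>,
  \<open>T \<ge> KR / (KT nT)\<close> and \<open>T \<ge> KR / (m_eq nT)\<close>. In the first range of cache sizes \<open>delta_p_ach\<close>
  equals the maximum of the first two bounds. In the second range \<open>m_eq \<ge> 1\<close>, so rounding
  \<open>m_eq\<close> down costs at most a factor 2.
\<close>

unbundle no inner_syntax

section \<open>Linear algebra of zero forcing\<close>

text \<open>Rows and columns of a submatrix are numbered through \<open>pick\<close>. This bijection
  turns a sum over such numbers into a sum over the index set itself.\<close>

lemma bij_betw_pick:
  assumes "finite S"
  shows "bij_betw (pick S) {..<card S} S"
proof (rule bij_betwI[where g = "\<lambda>i. card {a \<in> S. a < i}"])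
  show "pick S \<in> {..<card S} \<rightarrow> S"
    by (auto simp: pick_in_set_le)
  have "{a \<in> S. a < i} \<subset> S" if "i \<in> S" for i
    using that by auto
  then show "(\<lambda>i. card {a \<in> S. a < i}) \<in> S \<rightarrow> {..<card S}"
    using assms by (auto intro: psubset_card_mono)
qed (auto simp: pick_card_in_set card_pick_le)

text \<open>The inverse is given only by two product identities, so its dimensions are read off from
  them before associativity applies.\<close>

lemma invertible_mat_kernel:
  fixes A :: "'a :: comm_ring_1 mat"
  assumes "invertible_mat A" "A \<in> carrier_mat n n" "w \<in> carrier_vec n" "A *\<^sub>v w = 0\<^sub>v n"
  shows "w = 0\<^sub>v n"
proof -
  obtain B where B: "A * B = 1\<^sub>m n" "B * A = 1\<^sub>m (dim_row B)"
    using assms(1,2) unfolding invertible_mat_def inverts_mat_def by auto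
  have "dim_col B = n" using arg_cong[OF B(1), of dim_col] by simp
  moreover have "dim_row B = n" using arg_cong[OF B(2), of dim_col] assms(2) by simp
  ultimately have Bc: "B \<in> carrier_mat n n" and BA: "B * A = 1\<^sub>m n" using B(2) by auto
  have "w = (B * A) *\<^sub>v w" using assms(3) BA by simp
  also have "\<dots> = B *\<^sub>v (A *\<^sub>v w)" using Bc assms(2,3) by (rule assoc_mult_mat_vec)
  also have "\<dots> = 0\<^sub>v n" using assms(4) Bc by auto
  finally show ?thesis .
qed

text \<open>If \<open>R\<close> had more users than the edge nodes in \<open>A\<close> have
  antennas, one could choose as many users other than \<open>k\<close> as there are antennas. Their
  square channel submatrix is invertible and annihilates the stacked precoder, which is then zero
  and gives \<open>k\<close> no signal.\<close>

lemma zero_forcing_card_le: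
  fixes g :: channel and v :: "nat \<Rightarrow> complex vec"
  assumes nd: "nondegenerate KT KR nT g" and R: "R \<subseteq> {..<KR}" "k \<in> R"
    and A: "A \<subseteq> {..<KT}"
    and v: "\<And>i. i < KT \<Longrightarrow> v i \<in> carrier_vec nT"
    and v0: "\<And>i. i < KT \<Longrightarrow> i \<notin> A \<Longrightarrow> v i = 0\<^sub>v nT"
    and k: "(\<Sum>i<KT. g k i \<bullet> v i) \<noteq> 0"
    and k': "\<And>k'. k' \<in> R - {k} \<Longrightarrow> (\<Sum>i<KT. g k' i \<bullet> v i) = 0"
  shows "card R \<le> nT * card A"
proof (rule ccontr)
  assume "\<not> ?thesis"
  then have big: "nT * card A < card R" by simp
  define H where "H = channel_matrix KT KR nT g"
  \<comment> \<open>Antenna \<open>l\<close> of edge node \<open>i\<close> is column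
    \<open>i * nT + l\<close>; thus \<open>J\<close> collects the antennas of \<open>A\<close>, and
    \<open>V\<close> below stacks the precoders in the same numbering.\<close>
  define J where "J = {j. j < KT * nT \<and> j div nT \<in> A}"
  define V where "V j = v (j div nT) $ (j mod nT)" for j
  have finJ: "finite J" unfolding J_def by simp
  have "J = (\<lambda>(i, l). i * nT + l) ` (A \<times> {..<nT})"
  proof (intro equalityI subsetI)
    fix j assume j: "j \<in> J"
    then have "nT > 0" unfolding J_def by (cases nT) auto
    with j have "(j div nT, j mod nT) \<in> A \<times> {..<nT}" unfolding J_def by auto
    then show "j \<in> (\<lambda>(i, l). i * nT + l) ` (A \<times> {..<nT})"
      by (rule rev_image_eqI) simp
  next
    fix j assume "j \<in> (\<lambda>(i, l). i * nT + l) ` (A \<times> {..<nT})"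
    then obtain i l where il: "j = i * nT + l" "i \<in> A" "l < nT" by auto
    with A have "i < KT" by auto
    then have "Suc i * nT \<le> KT * nT" by (intro mult_le_mono1) simp
    with il show "j \<in> J" unfolding J_def by auto
  qed
  moreover have "inj_on (\<lambda>(i, l). i * nT + l) (A \<times> {..<nT})"
  proof (rule inj_on_inverseI)
    fix x assume "x \<in> A \<times> {..<nT}"
    then show "(\<lambda>j. (j div nT, j mod nT)) ((\<lambda>(i, l). i * nT + l) x) = x" by auto
  qed
  ultimately have cardJ: "card J = nT * card A"
    by (simp add: card_image card_cartesian_product mult.commute)
  have "card (R - {k}) \<ge> card J"
    using big R by (simp add: cardJ finite_subset[OF R(1)])
  then obtain I where I: "I \<subseteq> R - {k}" "card I = card J"
    by (metis obtain_subset_with_card_n)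
  have finI: "finite I" using I(1) R(1) by (meson finite_Diff finite_lessThan finite_subset)
  have IK: "I \<subseteq> {..<KR}" using I(1) R(1) by auto
  have JK: "J \<subseteq> {..<KT * nT}" unfolding J_def by auto
  have inv: "invertible_mat (submatrix H I J)"
    using nd IK JK I(2) unfolding nondegenerate_def H_def by blast
  have setI: "{i. i < dim_row H \<and> i \<in> I} = I"
    using IK unfolding H_def channel_matrix_def by auto
  have setJ: "{j. j < dim_col H \<and> j \<in> J} = J"
    using JK unfolding H_def channel_matrix_def by auto
  \<comment> \<open>The columns outside \<open>J\<close> drop out because the edge nodes outside
    \<open>A\<close> transmit zero.\<close>
  have received: "(\<Sum>i<KT. g q i \<bullet> v i) = (\<Sum>j\<in>J. H $$ (q, j) * V j)" if q: "q < KR" for q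
  proof -
    have "(\<Sum>i<KT. g q i \<bullet> v i) = (\<Sum>i<KT. \<Sum>j\<in>{i * nT..<i * nT + nT}. H $$ (q, j) * V j)"
    proof (rule sum.cong[OF refl])
      fix i assume i: "i \<in> {..<KT}"
      then have i': "Suc i * nT \<le> KT * nT" by (intro mult_le_mono1) simp
      have "g q i \<bullet> v i = (\<Sum>l\<in>{0..<nT}. g q i $ l * v i $ l)"
        using v[THEN carrier_vecD] i by (simp add: scalar_prod_def)
      also have "\<dots> = (\<Sum>l\<in>{0..<nT}. H $$ (q, l + i * nT) * V (l + i * nT))"
        using q i' by (intro sum.cong) (auto simp: H_def channel_matrix_def V_def)
      also have "\<dots> = (\<Sum>j\<in>{0 + i * nT..<nT + i * nT}. H $$ (q, j) * V j)"
        by (rule sum.shift_bounds_nat_ivl[symmetric])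
      finally show "g q i \<bullet> v i = (\<Sum>j\<in>{i * nT..<i * nT + nT}. H $$ (q, j) * V j)"
        by (simp add: add.commute)
    qed
    also have "\<dots> = (\<Sum>j<KT * nT. H $$ (q, j) * V j)"
      by (rule sum.nat_group)
    also have "\<dots> = (\<Sum>j\<in>J. H $$ (q, j) * V j)"
    proof (rule sum.mono_neutral_right)
      show "\<forall>j\<in>{..<KT * nT} - J. H $$ (q, j) * V j = 0"
      proof
        fix j assume j: "j \<in> {..<KT * nT} - J"
        then have "nT > 0" by (cases nT) auto
        moreover have "j div nT < KT" using j by (simp add: less_mult_imp_div_less)
        moreover have "j div nT \<notin> A" using j unfolding J_def by auto
        ultimately show "H $$ (q, j) * V j = 0" by (simp add: V_def v0)
      qed
    qed (use JK in auto)
    finally show ?thesis .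
  qed
  define w where "w = vec (card J) (\<lambda>j. V (pick J j))"
  have carr: "submatrix H I J \<in> carrier_mat (card J) (card J)"
    unfolding submatrix_def setI setJ using I(2) by simp
  have "submatrix H I J *\<^sub>v w = 0\<^sub>v (card J)"
  proof (rule eq_vecI)
    fix a assume "a < dim_vec (0\<^sub>v (card J) :: complex vec)"
    then have a: "a < card J" by simp
    then have pa: "pick I a \<in> I" using I(2) by (simp add: pick_in_set_le)
    have "(submatrix H I J *\<^sub>v w) $ a = (\<Sum>j<card J. H $$ (pick I a, pick J j) * V (pick J j))"
      using a carr I(2) by (auto simp: scalar_prod_def w_def submatrix_index setI setJ
          atLeast0LessThan intro!: sum.cong)
    also have "\<dots> = (\<Sum>j\<in>J. H $$ (pick I a, j) * V j)"
      by (rule sum.reindex_bij_betw[OF bij_betw_pick[OF finJ]])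
    also have "\<dots> = (\<Sum>i<KT. g (pick I a) i \<bullet> v i)"
      using received pa IK by (metis lessThan_iff subsetD)
    also have "\<dots> = 0" using k' pa I(1) by blast
    finally show "(submatrix H I J *\<^sub>v w) $ a = 0\<^sub>v (card J) $ a" using a by simp
  qed (use carr in auto)
  then have "w = 0\<^sub>v (card J)"
    using invertible_mat_kernel[OF inv carr] by (simp add: w_def)
  then have "V (pick J j) = 0" if "j < card J" for j
    using that by (metis index_vec index_zero_vec(1) w_def)
  then have "V j = 0" if "j \<in> J" for j
    using that bij_betw_pick[OF finJ] unfolding bij_betw_def by force
  then have "(\<Sum>i<KT. g k i \<bullet> v i) = 0"
    using received[of k] R by auto
  with k show False by simp
qed

section \<open>Convexity of the constraints\<close>

text \<open>
  The constraints that a normalized delivery time \<open>T\<close> has to satisfy. They are jointly convex in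
  \<open>(\<nu>, T)\<close>, so the least feasible \<open>T\<close> is a convex function of the cache size \<open>\<nu>\<close>.
\<close>

definition feasible_times :: "nat \<Rightarrow> nat \<Rightarrow> nat \<Rightarrow> real \<Rightarrow> real \<Rightarrow> real set" where
  "feasible_times KT KR nT r \<nu> =
     {T. 1 \<le> T \<and> real KR \<le> real KT * real nT * T \<and>
         real KR \<le> real KT * (real KR * \<nu> + r * T) \<and>
         (real KR)\<^sup>2 \<le> T * (real nT * real KT * (real KR * \<nu> + r * T))}"

text \<open>The region above a branch of a hyperbola is convex. Expanding the product leaves the
  cross term \<open>x * v + y * u\<close>, which is at least \<open>2 * c\<^sup>2\<close> because
  \<open>x / y + y / x \<ge> 2\<close>.\<close>

lemma hyperbola_convex:
  fixes c x u y v s t :: real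
  assumes "c\<^sup>2 \<le> x * u" "c\<^sup>2 \<le> y * v" "0 < x" "0 < y" "0 \<le> s" "0 \<le> t" "s + t = 1"
  shows "c\<^sup>2 \<le> (s * x + t * y) * (s * u + t * v)"
proof -
  have "c\<^sup>2 / x \<le> u" "c\<^sup>2 / y \<le> v" using assms by (auto simp: divide_simps mult.commute)
  then have "x * (c\<^sup>2 / y) + y * (c\<^sup>2 / x) \<le> x * v + y * u"
    using assms by (intro add_mono mult_left_mono) auto
  moreover have "2 * c\<^sup>2 \<le> x * (c\<^sup>2 / y) + y * (c\<^sup>2 / x)"
  proof -
    have "0 \<le> c\<^sup>2 * (x - y)\<^sup>2 / (x * y)" using assms by simp
    also have "\<dots> = x * (c\<^sup>2 / y) + y * (c\<^sup>2 / x) - 2 * c\<^sup>2"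
      using assms by (simp add: field_simps power2_eq_square)
    finally show ?thesis by simp
  qed
  ultimately have cross: "2 * c\<^sup>2 \<le> x * v + y * u" by linarith
  have "c\<^sup>2 = (s + t)\<^sup>2 * c\<^sup>2" using assms by simp
  also have "\<dots> = s * s * c\<^sup>2 + t * t * c\<^sup>2 + s * t * (2 * c\<^sup>2)"
    by (simp add: power2_eq_square algebra_simps)
  also have "\<dots> \<le> s * s * (x * u) + t * t * (y * v) + s * t * (x * v + y * u)"
    using assms cross by (intro add_mono mult_left_mono) auto
  also have "\<dots> = (s * x + t * y) * (s * u + t * v)" by (simp add: algebra_simps)
  finally show ?thesis .
qed

text \<open>The first three constraints are affine in the cache size and \<open>T\<close> jointly.
  The last one bounds a product of two affine functions from below, one of them being the positive
  \<open>T\<close>, so it is a hyperbola constraint.\<close>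

lemma feasible_times_convex:
  assumes "T1 \<in> feasible_times KT KR nT r x" "T2 \<in> feasible_times KT KR nT r y"
    and t: "0 < t" "t < (1 :: real)"
  shows "(1 - t) * T1 + t * T2 \<in> feasible_times KT KR nT r ((1 - t) * x + t * y)"
proof -
  have le: "c \<le> (1 - t) * a + t * b" if "c \<le> a" "c \<le> b" for a b c :: real
  proof -
    have "(1 - t) * c + t * c \<le> (1 - t) * a + t * b"
      using that t by (intro add_mono mult_left_mono) auto
    then show ?thesis by (simp add: algebra_simps)
  qed
  note T1 = assms(1)[unfolded feasible_times_def, simplified]
  note T2 = assms(2)[unfolded feasible_times_def, simplified]
  let ?u = "\<lambda>x T. real KR * x + r * T"
  have u: "?u ((1 - t) * x + t * y) ((1 - t) * T1 + t * T2) = (1 - t) * ?u x T1 + t * ?u y T2"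
    by (simp add: algebra_simps)
  have scale: "a * ((1 - t) * p + t * q) = (1 - t) * (a * p) + t * (a * q)" for a p q
    by (simp add: algebra_simps)
  have "1 \<le> (1 - t) * T1 + t * T2" using T1 T2 by (intro le) auto
  moreover have "real KR \<le> real KT * real nT * ((1 - t) * T1 + t * T2)"
    unfolding scale using T1 T2 by (intro le) auto
  moreover have "real KR \<le> real KT * ((1 - t) * ?u x T1 + t * ?u y T2)"
    unfolding scale using T1 T2 by (intro le) auto
  moreover have "(real KR)\<^sup>2 \<le> ((1 - t) * T1 + t * T2) *
      (real nT * real KT * ((1 - t) * ?u x T1 + t * ?u y T2))"
    unfolding scale[of "real nT * real KT"] using T1 T2 t by (intro hyperbola_convex) auto
  ultimately show ?thesis unfolding feasible_times_def mem_Collect_eq u by simp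
qed

text \<open>Minimizing over one coordinate of a convex set gives a convex function of the other.
  Minimizers need not exist, so the inequality is carried through infima; the lower bound 0 keeps
  them away from \<open>-\<infinity>\<close>.\<close>

lemma ereal_convex_on_Inf_section:
  fixes \<Phi> :: "real \<Rightarrow> real set"
  assumes lb: "\<And>x T. T \<in> \<Phi> x \<Longrightarrow> 0 \<le> T"
    and conv: "\<And>x y T1 T2 t. \<lbrakk>T1 \<in> \<Phi> x; T2 \<in> \<Phi> y; 0 < t; t < 1\<rbrakk>
                 \<Longrightarrow> (1 - t) * T1 + t * T2 \<in> \<Phi> ((1 - t) * x + t * y)"
  shows "ereal_convex_on S (\<lambda>x. INF T\<in>\<Phi> x. ereal T)"
proof -
  let ?g = "\<lambda>x. INF T\<in>\<Phi> x. ereal T"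
  have nonneg: "0 \<le> ?g x" for x
    using lb by (intro INF_greatest) auto
  have "?g ((1 - t) * x + t * y) \<le> ereal (1 - t) * ?g x + ereal t * ?g y"
    if t: "0 < t" "t < 1" for x y t
  proof -
    have scale: "(INF T\<in>\<Phi> x. ereal (c * T)) \<le> ereal c * ?g x" if "c > 0" for c x
    proof -
      have "(INF T\<in>\<Phi> x. ereal (c * T)) / ereal c \<le> ereal T" if "T \<in> \<Phi> x" for T
        using INF_lower[OF that, of "\<lambda>T. ereal (c * T)"] \<open>c > 0\<close>
        by (subst ereal_divide_le_pos) auto
      then have "(INF T\<in>\<Phi> x. ereal (c * T)) / ereal c \<le> ?g x"
        by (rule INF_greatest)
      then show ?thesis using \<open>c > 0\<close> by (subst (asm) ereal_divide_le_pos) auto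
    qed
    show ?thesis
    proof (cases "\<Phi> x = {} \<or> \<Phi> y = {}")
      case True
      \<comment> \<open>An empty section has infimum \<open>\<infinity>\<close>, and the other
        summand is nonnegative, so the right-hand side is infinite.\<close>
      then have "?g x = \<infinity> \<or> ?g y = \<infinity>" by (auto simp: top_ereal_def)
      then show ?thesis using t nonneg[of x] nonneg[of y] by auto
    next
      case False
      have "?g ((1 - t) * x + t * y)
          \<le> (INF T1\<in>\<Phi> x. INF T2\<in>\<Phi> y. ereal ((1 - t) * T1) + ereal (t * T2))"
        using conv t by (intro INF_greatest INF_lower2[where i = "(1 - t) * _ + t * _"]) auto
      also have "\<dots> = (INF T1\<in>\<Phi> x. ereal ((1 - t) * T1) + (INF T2\<in>\<Phi> y. ereal (t * T2)))"
        using False t by (intro INF_cong refl INF_ereal_add_right) (auto simp: lb)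
      also have "\<dots> = (INF T1\<in>\<Phi> x. ereal ((1 - t) * T1)) + (INF T2\<in>\<Phi> y. ereal (t * T2))"
      proof (rule INF_ereal_add_left)
        have "0 \<le> (INF T2\<in>\<Phi> y. ereal (t * T2))"
          using t lb by (intro INF_greatest) auto
        then show "(INF T2\<in>\<Phi> y. ereal (t * T2)) \<noteq> -\<infinity>" by auto
      qed (use False t lb in auto)
      also have "\<dots> \<le> ereal (1 - t) * ?g x + ereal t * ?g y"
        using t by (intro add_mono scale) auto
      finally show ?thesis .
    qed
  qed
  moreover have "?g x \<noteq> -\<infinity>" for x
    using nonneg[of x] by auto
  ultimately show ?thesis unfolding ereal_convex_on_def by auto
qed


section \<open>Counting packets, copies and blocks\<close>

text \<open>A block lasts at least as long as the transfer to any single edge node in it. For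
  \<open>r = 0\<close> nothing is sent, so the left-hand side vanishes.\<close>

lemma sum_fronthaul_le:
  assumes "F \<ge> 1" "r \<ge> 0" "valid_fronthaul KT KR r F d D" "i < KT"
  shows "(\<Sum>b<num_blocks D. real (card (fronthaul D b i))) \<le> real F * r * delivery_time KT r F D"
  unfolding delivery_time_def sum_distrib_left
proof (rule sum_mono)
  fix b assume b: "b \<in> {..<num_blocks D}"
  show "real (card (fronthaul D b i)) \<le> real F * r * max (fronthaul_time KT r F D b) (1 / real F)"
  proof (cases "r = 0")
    case True
    then show ?thesis using assms(3,4) b unfolding valid_fronthaul_def by auto
  next
    case False
    have "card (fronthaul D b i) \<le> Max ((\<lambda>i. card (fronthaul D b i)) ` {..<KT})"
      using assms(4) by (intro Max_ge) auto
    then have "real (card (fronthaul D b i)) \<le> real F * r * fronthaul_time KT r F D b"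
      using False assms(1) by (simp add: fronthaul_time_def)
    also have "\<dots> \<le> real F * r * max (fronthaul_time KT r F D b) (1 / real F)"
      using assms(2) by (intro mult_left_mono) auto
    finally show ?thesis .
  qed
qed

lemma num_blocks_le_delivery_time:
  assumes "F \<ge> 1"
  shows "real (num_blocks D) \<le> real F * delivery_time KT r F D"
proof -
  have "(\<Sum>b<num_blocks D. 1 / real F) \<le> delivery_time KT r F D"
    unfolding delivery_time_def by (intro sum_mono) auto
  then show ?thesis using assms by (simp add: divide_simps mult.commute)
qed

text \<open>Double counting of pairs of a packet and an edge node holding it in the end. Each edge
  node caches at most \<open>\<nu> * F\<close> packets of each of the \<open>KR\<close> requested
  files and receives at most \<open>F * r * T\<close> more, where \<open>T\<close> is the delivery
  time.\<close>

lemma sum_copies_le: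
  fixes d :: "nat \<Rightarrow> nat"
  assumes F: "F \<ge> 1" and r: "r \<ge> 0"
    and fronthaul: "valid_fronthaul KT KR r F d D"
    and caching: "valid_caching KT N \<nu> F C"
    and d: "inj_on d {..<KR}" "d \<in> {..<KR} \<rightarrow> {..<N}"
  shows "(\<Sum>p\<in>{..<KR} \<times> {..<F}.
            real (card {i. i < KT \<and> (d (fst p), snd p) \<in> available N C D (num_blocks D) i}))
         \<le> real F * (real KT * (real KR * \<nu> + r * delivery_time KT r F D))"
    (is "(\<Sum>p\<in>?P. real (card (?A p))) \<le> _")
proof -
  let ?S = "\<lambda>i. {p \<in> ?P. (d (fst p), snd p) \<in> available N C D (num_blocks D) i}"
  have "(\<Sum>p\<in>?P. card (?A p)) = (\<Sum>i<KT. card (?S i))"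
    using sum_multicount_gen[of ?P "{..<KT}"
        "\<lambda>p i. (d (fst p), snd p) \<in> available N C D (num_blocks D) i" "\<lambda>i. card (?S i)"]
    by (simp add: lessThan_def)
  then have "(\<Sum>p\<in>?P. real (card (?A p))) = (\<Sum>i<KT. real (card (?S i)))"
    by (simp flip: of_nat_sum)
  also have "\<dots> \<le> (\<Sum>i<KT. real F * (real KR * \<nu> + r * delivery_time KT r F D))"
  proof (rule sum_mono)
    fix i assume "i \<in> {..<KT}"
    then have i: "i < KT" by simp
    let ?cached = "\<Union>k<KR. {d k} \<times> C i (d k)" and ?sent = "\<Union>b<num_blocks D. fronthaul D b i"
    have C: "C i (d k) \<subseteq> {..<F}" "real (card (C i (d k))) \<le> \<nu> * real F" if "k < KR" for k
      using caching d(2) i that unfolding valid_caching_def by blast+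
    have fin_cached: "finite ?cached"
      using C(1) by (intro finite_UN_I) (auto intro: finite_subset)
    have "finite (fronthaul D b i)" if "b < num_blocks D" for b
    proof (rule finite_subset)
      show "fronthaul D b i \<subseteq> d ` {..<KR} \<times> {..<F}"
        using fronthaul i that unfolding valid_fronthaul_def by blast
    qed simp
    then have fin_sent: "finite ?sent" by simp
    \<comment> \<open>Distinct requests ensure that packets indexed by user and position are
      distinct packets of the library.\<close>
    have "inj_on (\<lambda>p. (d (fst p), snd p)) (?S i)"
      using d(1) by (auto simp: inj_on_def)
    moreover have "(\<lambda>p. (d (fst p), snd p)) ` ?S i \<subseteq> ?cached \<union> ?sent"
      by (auto simp: available_def)
    ultimately have "card (?S i) \<le> card (?cached \<union> ?sent)"
      by (rule card_inj_on_le[OF _ _ finite_UnI[OF fin_cached fin_sent]])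
    also have "\<dots> \<le> card ?cached + card ?sent"
      by (rule card_Un_le)
    also have "\<dots> \<le> (\<Sum>k<KR. card ({d k} \<times> C i (d k))) + (\<Sum>b<num_blocks D. card (fronthaul D b i))"
      by (intro add_mono card_UN_le) auto
    finally have "real (card (?S i)) \<le>
        real ((\<Sum>k<KR. card (C i (d k))) + (\<Sum>b<num_blocks D. card (fronthaul D b i)))"
      by (simp add: card_cartesian_product del: of_nat_add)
    also have "\<dots> = (\<Sum>k<KR. real (card (C i (d k)))) + (\<Sum>b<num_blocks D. real (card (fronthaul D b i)))"
      by simp
    also have "\<dots> \<le> (\<Sum>k<KR. \<nu> * real F) + real F * r * delivery_time KT r F D"
      using C(2) by (intro add_mono sum_mono sum_fronthaul_le[OF F r fronthaul i]) auto
    also have "\<dots> = real F * (real KR * \<nu> + r * delivery_time KT r F D)"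
      by (simp add: algebra_simps)
    finally show "real (card (?S i)) \<le> real F * (real KR * \<nu> + r * delivery_time KT r F D)" .
  qed
  finally show ?thesis by (simp add: algebra_simps)
qed

text \<open>
  By zero forcing a packet delivered in a block together with \<open>m - 1\<close> others must be present at
  \<open>m / nT\<close> edge nodes at least. Summing over all packets, Cauchy-Schwarz over the blocks bounds
  the number of copies that caches and fronthaul have to provide.
\<close>

lemma delivery_time_feasible:
  fixes d :: "nat \<Rightarrow> nat"
  assumes pos: "KR \<ge> 1" "F \<ge> 1" "r \<ge> 0"
    and nd: "\<And>b. nondegenerate KT KR nT (h b)"
    and caching: "valid_caching KT N \<nu> F C"
    and fronthaul: "valid_fronthaul KT KR r F d D"
    and transmission: "valid_transmission KT KR nT N h F C d D"
    and all: "delivers_all KR F D"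
    and d: "inj_on d {..<KR}" "d \<in> {..<KR} \<rightarrow> {..<N}"
  shows "delivery_time KT r F D \<in> feasible_times KT KR nT r \<nu>"
proof -
  let ?P = "{..<KR} \<times> {..<F}" and ?B = "num_blocks D" and ?T = "delivery_time KT r F D"
  let ?U = "real KT * (real KR * \<nu> + r * ?T)"
  \<comment> \<open>Holders are taken after the last block; those that hold the packet when it is
    transmitted are among them.\<close>
  define A where "A p = {i. i < KT \<and> (d (fst p), snd p) \<in> available N C D ?B i}" for p
  have copies: "(\<Sum>p\<in>?P. real (card (A p))) \<le> real F * ?U"
    using sum_copies_le[OF pos(2,3) fronthaul caching d] unfolding A_def .
  have "\<forall>p\<in>?P. \<exists>b<?B. fst p \<in> served D b \<and> pkt D b (fst p) = snd p"
    using all unfolding delivers_all_def by auto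
  \<comment> \<open>A packet may be delivered repeatedly; \<open>bl\<close> fixes one delivering
    block for each packet, so that every packet is counted once.\<close>
  then obtain bl where bl: "\<And>p. p \<in> ?P \<Longrightarrow> bl p < ?B \<and> fst p \<in> served D (bl p) \<and> pkt D (bl p) (fst p) = snd p"
    by metis
  have served: "served D b \<subseteq> {..<KR}" if "b < ?B" for b
    using transmission that unfolding valid_transmission_def by blast
  have card_served: "card (served D (bl p)) \<le> nT * card (A p)" if p: "p \<in> ?P" for p
  proof (rule zero_forcing_card_le[OF nd[of "bl p"] served])
    note b = bl[OF p]
    have tr: "(\<forall>i<KT. precoder D (bl p) i (fst p) \<in> carrier_vec nT \<and>
          ((d (fst p), snd p) \<notin> available N C D (bl p) i \<longrightarrow> precoder D (bl p) i (fst p) = 0\<^sub>v nT)) \<and>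
        (\<Sum>i<KT. h (bl p) (fst p) i \<bullet> precoder D (bl p) i (fst p)) \<noteq> 0 \<and>
        (\<forall>k'\<in>served D (bl p) - {fst p}. (\<Sum>i<KT. h (bl p) k' i \<bullet> precoder D (bl p) i (fst p)) = 0)"
      using bspec[OF conjunct2[OF spec[OF transmission[unfolded valid_transmission_def],
            of "bl p", THEN mp]], of "fst p"] b
      by simp
    have "available N C D (bl p) i \<subseteq> available N C D ?B i" for i
      using b unfolding available_def by (auto intro: less_trans)
    then show "precoder D (bl p) i (fst p) = 0\<^sub>v nT" if "i < KT" "i \<notin> A p" for i
      using tr that unfolding A_def by blast
    show "precoder D (bl p) i (fst p) \<in> carrier_vec nT" if "i < KT" for i
      using tr that by blast
    show "(\<Sum>i<KT. h (bl p) (fst p) i \<bullet> precoder D (bl p) i (fst p)) \<noteq> 0"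
      using tr by blast
    show "(\<Sum>i<KT. h (bl p) k' i \<bullet> precoder D (bl p) i (fst p)) = 0" if "k' \<in> served D (bl p) - {fst p}" for k'
      using tr that by blast
  qed (use bl[OF p] in \<open>auto simp: A_def\<close>)
  define n where "n b = card {p \<in> ?P. bl p = b}" for b
  have n_le: "n b \<le> card (served D b)" if "b < ?B" for b
    unfolding n_def
  proof (rule card_inj_on_le[where f = fst])
    show "inj_on fst {p \<in> ?P. bl p = b}"
      by (rule inj_on_inverseI[where g = "\<lambda>k. (k, pkt D b k)"]) (use bl in \<open>auto simp: prod_eq_iff\<close>)
    show "fst ` {p \<in> ?P. bl p = b} \<subseteq> served D b"
      using bl by auto
    show "finite (served D b)" using served[OF that] by (rule finite_subset) simp
  qed
  have count: "(\<Sum>p\<in>?P. f (bl p)) = (\<Sum>b<?B. real (n b) * f b)" for f :: "nat \<Rightarrow> real"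
  proof -
    have "(\<Sum>b<?B. \<Sum>p\<in>{p \<in> ?P. bl p = b}. f (bl p)) = (\<Sum>p\<in>?P. f (bl p))"
      by (rule sum.group) (use bl in auto)
    then show ?thesis by (simp add: n_def)
  qed
  have total: "real KR * real F = (\<Sum>b<?B. real (n b))"
    using count[of "\<lambda>_. 1"] by simp
  have F: "real F > 0" using pos(2) by simp
  have blocks: "real ?B \<le> real F * ?T"
    by (rule num_blocks_le_delivery_time[OF pos(2)])
  \<comment> \<open>With at most \<open>c\<close> packets per block, at least
    \<open>KR * F / c\<close> blocks of length at least \<open>1 / F\<close> are needed when
    \<open>c > 0\<close>. Taking \<open>c = KR\<close> gives \<open>T \<ge> 1\<close>, and
    \<open>c = KT * nT\<close> gives the antenna bound.\<close>
  have bound: "real KR \<le> c * ?T" if c: "c \<ge> 0" and n: "\<And>b. b < ?B \<Longrightarrow> real (n b) \<le> c" for c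
  proof -
    have "real F * real KR = (\<Sum>b<?B. real (n b))" using total by (simp add: mult.commute)
    also have "\<dots> \<le> (\<Sum>b<?B. c)" using n by (intro sum_mono) auto
    also have "\<dots> = c * real ?B" by simp
    also have "\<dots> \<le> c * (real F * ?T)"
      using blocks c by (rule mult_left_mono)
    finally have "real F * real KR \<le> real F * (c * ?T)" by (simp add: mult_ac)
    then show ?thesis using F by simp
  qed
  have "real KR \<le> real KR * ?T"
  proof (rule bound)
    fix b assume b: "b < ?B"
    have "n b \<le> card {..<KR}"
      using n_le[OF b] card_mono[OF _ served[OF b]] by fastforce
    then show "real (n b) \<le> real KR" by simp
  qed simp
  then have one: "1 \<le> ?T" using pos(1) by simp
  have antennas: "real KR \<le> (real KT * real nT) * ?T"
  proof (rule bound)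
    fix b assume b: "b < ?B"
    show "real (n b) \<le> real KT * real nT"
    \<comment> \<open>The zero-forcing bound needs a packet assigned to the block; without one,
      \<open>n b = 0\<close>.\<close>
    proof (cases "\<exists>p\<in>?P. bl p = b")
      case True
      then obtain p where p: "p \<in> ?P" "bl p = b" by blast
      have "card (A p) \<le> card {..<KT}" by (intro card_mono) (auto simp: A_def)
      then have "nT * card (A p) \<le> nT * KT" by simp
      with n_le[OF b] card_served[OF p(1), unfolded p(2)] have "n b \<le> nT * KT" by linarith
      then have "n b \<le> KT * nT" by (simp only: mult.commute)
      then show ?thesis by (simp flip: of_nat_mult)
    next
      case False
      then have "n b = 0" unfolding n_def by (auto simp: card_eq_0_iff)
      then show ?thesis by simp
    qed
  qed simp
  \<comment> \<open>Every packet has at least one holder, since the block delivering it serves at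
    least its own user.\<close>
  have "real F * real KR = (\<Sum>p\<in>?P. 1)" by simp
  also have "\<dots> \<le> (\<Sum>p\<in>?P. real (card (A p)))"
  proof (rule sum_mono)
    fix p assume p: "p \<in> ?P"
    have "finite (served D (bl p))"
      using served bl[OF p] by (meson finite_lessThan finite_subset)
    then have "card (served D (bl p)) > 0" using bl[OF p] by (auto simp: card_gt_0_iff)
    then have "card (A p) > 0" using card_served[OF p] by (cases "card (A p)") auto
    then show "1 \<le> real (card (A p))" by simp
  qed
  also note copies
  finally have once: "real KR \<le> ?U" using F by simp
  \<comment> \<open>Cauchy-Schwarz over the blocks. The sum of the squares of \<open>n b\<close>
    equals the sum of \<open>n (bl p)\<close> over all packets \<open>p\<close>, and zero forcing
    bounds each such term by \<open>nT\<close> times the number of holders.\<close>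
  have "(real KR * real F)\<^sup>2 \<le> (\<Sum>b<?B. (real (n b))\<^sup>2) * card {..<?B}"
    unfolding total by (rule sum_squared_le_sum_of_squares)
  also have "\<dots> = (\<Sum>p\<in>?P. real (n (bl p))) * real ?B"
    using count[of "\<lambda>b. real (n b)"] by (simp add: power2_eq_square)
  also have "\<dots> \<le> (real nT * (real F * ?U)) * (real F * ?T)"
  proof (intro mult_mono blocks)
    have "(\<Sum>p\<in>?P. real (n (bl p))) \<le> (\<Sum>p\<in>?P. real nT * real (card (A p)))"
    proof (rule sum_mono)
      fix p assume p: "p \<in> ?P"
      then have "n (bl p) \<le> nT * card (A p)"
        using n_le card_served bl by (meson le_trans)
      then show "real (n (bl p)) \<le> real nT * real (card (A p))" by (simp flip: of_nat_mult)
    qed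
    also have "\<dots> \<le> real nT * (real F * ?U)"
      using copies by (simp add: mult_left_mono flip: sum_distrib_left)
    finally show "(\<Sum>p\<in>?P. real (n (bl p))) \<le> real nT * (real F * ?U)" .
    show "0 \<le> real nT * (real F * ?U)" using once by simp
  qed auto
  finally have "(real F)\<^sup>2 * (real KR)\<^sup>2 \<le> (real F)\<^sup>2 * (?T * (real nT * ?U))"
    by (simp add: power2_eq_square mult_ac)
  then have "(real KR)\<^sup>2 \<le> ?T * (real nT * ?U)" using F by simp
  with one antennas once show ?thesis
    unfolding feasible_times_def by (simp add: mult.assoc)
qed

section \<open>From single deliveries to the minimum NDT\<close>

text \<open>Passes feasibility from the delivery time of one request vector to the maximum over all
  of them; each constraint is monotone in \<open>T\<close> because \<open>r \<ge> 0\<close>.\<close>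

lemma feasible_times_upward:
  assumes T: "T \<in> feasible_times KT KR nT r \<nu>" "T \<le> T'" and r: "r \<ge> 0"
  shows "T' \<in> feasible_times KT KR nT r \<nu>"
proof -
  note T1 = T(1)[unfolded feasible_times_def, simplified]
  have "r * T \<le> r * T'" using T(2) r by (rule mult_left_mono)
  then have U: "real KT * (real KR * \<nu> + r * T) \<le> real KT * (real KR * \<nu> + r * T')"
    by (intro mult_left_mono) auto
  have "real KT * real nT * T \<le> real KT * real nT * T'"
    using T(2) by (intro mult_left_mono) auto
  moreover have "T * (real nT * (real KT * (real KR * \<nu> + r * T)))
      \<le> T' * (real nT * (real KT * (real KR * \<nu> + r * T')))"
  proof (intro mult_mono[OF T(2)] mult_left_mono[OF U])
    have "0 \<le> real KT * (real KR * \<nu> + r * T)" using T1 by linarith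
    then show "0 \<le> real nT * (real KT * (real KR * \<nu> + r * T))"
      by (rule mult_nonneg_nonneg[OF of_nat_0_le_iff])
  qed (use T1 T(2) in auto)
  ultimately show ?thesis
    using T1 T(2) U unfolding feasible_times_def by (simp add: mult.assoc)
qed

text \<open>The NDT is at least the delivery time when user \<open>k\<close> requests file
  \<open>k\<close>. These requests are pairwise distinct and exist because
  \<open>N \<ge> KR\<close>.\<close>

lemma policy_NDT_feasible:
  assumes pos: "KT \<ge> 1" "KR \<ge> 1" "N \<ge> KR" "r \<ge> 0"
    and nd: "\<And>b. nondegenerate KT KR nT (h b)"
    and policy: "valid_policy KT KR nT N h \<nu> r F C \<D>"
  shows "policy_NDT KT KR N r F \<D> \<in> feasible_times KT KR nT r \<nu>"
proof -
  define d where "d = restrict id {..<KR}"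
  have d: "d \<in> requests KR N" unfolding d_def requests_def using pos(3) by auto
  have "delivery_time KT r F (\<D> d) \<in> feasible_times KT KR nT r \<nu>"
  proof (rule delivery_time_feasible[OF pos(2) _ pos(4) nd])
    show "inj_on d {..<KR}" "d \<in> {..<KR} \<rightarrow> {..<N}"
      using pos(3) by (auto simp: d_def inj_on_def)
  qed (use policy d in \<open>auto simp: valid_policy_def\<close>)
  moreover have "delivery_time KT r F (\<D> d) \<le> policy_NDT KT KR N r F \<D>"
    unfolding policy_NDT_def requests_def
    by (rule Max_ge) (use d in \<open>auto simp: requests_def intro: finite_PiE\<close>)
  ultimately show ?thesis
    using feasible_times_upward pos(4) by blast
qed

text \<open>The least feasible time is convex in the cache size and lies below the NDT of every
  policy, so it is one of the minorants whose supremum is the envelope.\<close>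

lemma delta_star_P_ge:
  assumes "KT \<ge> 1" "KR \<ge> 1" "N \<ge> KR" "r \<ge> 0" "\<And>b. nondegenerate KT KR nT (h b)"
  shows "(INF T\<in>feasible_times KT KR nT r \<mu>. ereal T) \<le> delta_star_P KT KR nT N h \<mu> r"
  unfolding delta_star_P_def lower_convex_envelope_def
proof (rule Sup_upper, rule CollectI, intro exI conjI ballI)
  show "ereal_convex_on {0..1} (\<lambda>\<nu>. INF T\<in>feasible_times KT KR nT r \<nu>. ereal T)"
    by (intro ereal_convex_on_Inf_section feasible_times_convex) (auto simp: feasible_times_def)
  show "(INF T\<in>feasible_times KT KR nT r \<nu>. ereal T) \<le> delta_bar_P KT KR nT N h \<nu> r" for \<nu>
    unfolding delta_bar_P_def
    by (rule Inf_greatest) (use policy_NDT_feasible[OF assms] in \<open>auto intro: INF_lower\<close>)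
qed simp

lemma lower_convex_envelope_le:
  "x \<in> S \<Longrightarrow> lower_convex_envelope S f x \<le> f x"
  unfolding lower_convex_envelope_def by (rule Sup_least) auto

section \<open>Comparison with the achievable NDT\<close>

text \<open>Substituting \<open>KR = q * nT * T\<close> cancels \<open>T\<^sup>2\<close> in the last
  constraint and leaves \<open>nT * q\<^sup>2 \<le> KT * (nT * \<mu> * q + r)\<close>. The larger
  root of this quadratic is \<open>m_eq\<close>, as completing the square shows.\<close>

lemma multiplicity_le_m_eq:
  assumes pos: "nT \<ge> 1" and T: "T \<in> feasible_times KT KR nT r \<mu>"
  shows "real KR / (real nT * T) \<le> m_eq KT nT \<mu> r"
proof -
  have nT: "real nT > 0" and T0: "T > 0" using pos T by (auto simp: feasible_times_def)
  define q where "q = real KR / (real nT * T)"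
  have q: "real KR = q * real nT * T" using nT T0 by (simp add: q_def)
  have "(real KR)\<^sup>2 \<le> T * (real nT * real KT * (real KR * \<mu> + r * T))"
    using T by (simp add: feasible_times_def)
  then have "T\<^sup>2 * ((real nT)\<^sup>2 * q\<^sup>2) \<le> T\<^sup>2 * (real nT * real KT * (q * real nT * \<mu> + r))"
    unfolding q by (simp add: power2_eq_square algebra_simps)
  then have "(real nT)\<^sup>2 * q\<^sup>2 \<le> real nT * real KT * (q * real nT * \<mu> + r)"
    using T0 by simp
  then have "(2 * real nT * q - \<mu> * real KT * real nT)\<^sup>2
      \<le> (\<mu> * real KT * real nT)\<^sup>2 + 4 * real nT * real KT * r"
    by (simp add: power2_eq_square algebra_simps)
  then have "2 * real nT * q - \<mu> * real KT * real nT
      \<le> sqrt ((\<mu> * real KT * real nT)\<^sup>2 + 4 * real nT * real KT * r)"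
    by (rule real_le_rsqrt)
  moreover have "2 * real nT * m_eq KT nT \<mu> r = \<mu> * real KT * real nT +
      sqrt ((\<mu> * real KT * real nT)\<^sup>2 + 4 * real nT * real KT * r)"
    using nT by (simp add: m_eq_def distrib_left)
  ultimately have "2 * real nT * q \<le> 2 * real nT * m_eq KT nT \<mu> r"
    by linarith
  then have "q \<le> m_eq KT nT \<mu> r" using nT by simp
  then show ?thesis by (simp add: q_def)
qed

text \<open>The hypothesis says that 1 satisfies the quadratic inequality in \<open>q\<close> whose
  larger root is \<open>m_eq\<close>.\<close>

lemma m_eq_ge_1:
  assumes pos: "nT \<ge> 1" and "1 - real KT * r / real nT \<le> \<mu> * real KT"
  shows "1 \<le> m_eq KT nT \<mu> r"
proof -
  have nT: "real nT > 0" using pos by simp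
  let ?s = "\<mu> * real KT * real nT"
  have "real nT \<le> ?s + real KT * r"
    using assms(2) nT by (simp add: field_simps)
  then have "4 * real nT * real nT \<le> 4 * real nT * (?s + real KT * r)"
    using nT by (intro mult_left_mono) auto
  then have "(2 * real nT - ?s)\<^sup>2 \<le> ?s\<^sup>2 + 4 * real nT * real KT * r"
    by (simp add: power2_eq_square algebra_simps)
  then have "2 * real nT - ?s \<le> sqrt (?s\<^sup>2 + 4 * real nT * real KT * r)"
    by (rule real_le_rsqrt)
  then show ?thesis using nT by (simp add: m_eq_def field_simps)
qed

text \<open>Only rounding \<open>m_eq\<close> down costs the factor 2; the first range and the
  saturated case \<open>m_max\<close> are already bounded by \<open>T\<close>.\<close>

lemma delta_p_ach_le_feasible:
  assumes pos: "KT \<ge> 1" "KR \<ge> 1" "nT \<ge> 1" and \<mu>: "0 \<le> \<mu>" "\<mu> \<le> 1" and r: "r \<ge> 0"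
    and T: "T \<in> feasible_times KT KR nT r \<mu>"
  shows "delta_p_ach KT KR nT \<mu> r \<le> ereal (2 * T)"
proof -
  have nT: "real nT > 0" and KR: "real KR > 0" using pos by auto
  have T1: "1 \<le> T" and TK: "real KR \<le> real KT * real nT * T"
    and TU: "real KR \<le> real KT * (real KR * \<mu> + r * T)"
    using T by (auto simp: feasible_times_def)
  show ?thesis
  proof (cases "\<mu> * real KT < max (1 - real KT * r / real nT) 0")
    case True
    \<comment> \<open>Without fronthaul the caches jointly hold too little in this range, so no time
      would be feasible.\<close>
    have "r \<noteq> 0"
    proof
      assume "r = 0"
      then have "\<mu> * real KT < 1" using True by simp
      then have "real KR * (\<mu> * real KT) < real KR * 1" using KR by (intro mult_strict_left_mono) auto
      then show False using TU \<open>r = 0\<close> by (simp add: mult_ac)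
    qed
    then have KTr: "real KT * r > 0" using r pos by simp
    have "real KR * (1 - \<mu> * real KT) / (real KT * r) \<le> T"
      using TU KTr by (simp add: pos_divide_le_eq algebra_simps)
    then show ?thesis using True \<open>r \<noteq> 0\<close> T1 by (simp add: delta_p_ach_def)
  next
    case False
    then have range: "\<mu> \<in> {\<nu>. 0 \<le> \<nu> \<and> \<nu> \<le> 1 \<and> \<nu> * real KT \<ge> max (1 - real KT * r / real nT) 0}"
      using \<mu> by auto
    have "real KR / (real_of_int (m_p KT KR nT \<mu> r) * real nT) \<le> 2 * T"
    proof (cases "\<mu> * real KT \<le> real_of_int (m_max KT KR nT)
        - real KT * r / (real_of_int (m_max KT KR nT) * real nT)")
      case True
      let ?m = "m_eq KT nT \<mu> r"
      have m1: "1 \<le> ?m" using m_eq_ge_1 pos(3) False by simp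
      then have "1 \<le> \<lfloor>?m\<rfloor>" by linarith
      then have mp: "m_p KT KR nT \<mu> r = \<lfloor>?m\<rfloor>" using True by (simp add: m_p_def)
      \<comment> \<open>For \<open>x \<ge> 1\<close> one has
        \<open>x < \<lfloor>x\<rfloor> + 1 \<le> 2 * \<lfloor>x\<rfloor>\<close>.\<close>
      have "?m \<le> 2 * real_of_int \<lfloor>?m\<rfloor>" using \<open>1 \<le> \<lfloor>?m\<rfloor>\<close> by linarith
      with multiplicity_le_m_eq[OF pos(3) T]
      have "real KR / (real nT * T) \<le> 2 * real_of_int \<lfloor>?m\<rfloor>" by linarith
      then have "real KR \<le> 2 * real_of_int \<lfloor>?m\<rfloor> * (real nT * T)"
        using nT T1 by (simp add: pos_divide_le_eq)
      moreover have "real_of_int \<lfloor>?m\<rfloor> * real nT > 0" using \<open>1 \<le> \<lfloor>?m\<rfloor>\<close> nT by simp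
      ultimately show ?thesis unfolding mp by (simp add: pos_divide_le_eq mult_ac)
    next
      case False
      then have mp: "m_p KT KR nT \<mu> r = m_max KT KR nT" by (simp add: m_p_def)
      \<comment> \<open>If \<open>m_max\<close> is \<open>KT\<close>, this is the antenna
        constraint. If it is the ceiling, \<open>m_max * nT\<close> already reaches
        \<open>KR\<close> and \<open>T \<ge> 1\<close> suffices.\<close>
      have "real KR \<le> T * (real_of_int (m_max KT KR nT) * real nT) \<and> m_max KT KR nT > 0"
      proof (cases "int KT \<le> \<lceil>real KR / real nT\<rceil>")
        case True
        then have "m_max KT KR nT = int KT" by (simp add: m_max_def)
        then show ?thesis using TK pos(1) by (simp add: mult_ac)
      next
        case False
        then have mm: "m_max KT KR nT = \<lceil>real KR / real nT\<rceil>" by (simp add: m_max_def)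
        have "real KR / real nT \<le> real_of_int \<lceil>real KR / real nT\<rceil>" by (rule le_of_int_ceiling)
        then have le: "real KR \<le> real_of_int \<lceil>real KR / real nT\<rceil> * real nT"
          using nT by (simp only: pos_divide_le_eq)
        also have "\<dots> \<le> T * (real_of_int \<lceil>real KR / real nT\<rceil> * real nT)"
          using mult_right_mono[OF T1, of "real_of_int \<lceil>real KR / real nT\<rceil> * real nT"] le KR by simp
        finally have "real KR \<le> T * (real_of_int \<lceil>real KR / real nT\<rceil> * real nT)" .
        moreover have "\<lceil>real KR / real nT\<rceil> > 0" using KR nT by simp
        ultimately show ?thesis unfolding mm by blast
      qed
      then have "real KR / (real_of_int (m_max KT KR nT) * real nT) \<le> T"
        using nT by (simp add: pos_divide_le_eq)
      then show ?thesis using T1 mp by simp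
    qed
    then have "ereal (max (real KR / (real_of_int (m_p KT KR nT \<mu> r) * real nT)) 1) \<le> ereal (2 * T)"
      using T1 by simp
    \<comment> \<open>Passing to the envelope only lowers the value at \<open>\<mu>\<close>, so the
      pointwise bound is enough.\<close>
    then have "lower_convex_envelope
        {\<nu>. 0 \<le> \<nu> \<and> \<nu> \<le> 1 \<and> \<nu> * real KT \<ge> max (1 - real KT * r / real nT) 0}
        (\<lambda>\<nu>. ereal (max (real KR / (real_of_int (m_p KT KR nT \<nu> r) * real nT)) 1)) \<mu> \<le> ereal (2 * T)"
      using lower_convex_envelope_le[OF range] by (rule order_trans[rotated])
    then show ?thesis using False by (simp only: delta_p_ach_def if_False)
  qed
qed

theorem proposition10:
  fixes KT KR nT N :: nat
    and h :: "nat \<Rightarrow> channel"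
    and \<mu> r :: real
  assumes "KT \<ge> 1" and "KR \<ge> 1" and "nT \<ge> 1" and "N \<ge> KR"
    and "\<And>b. nondegenerate KT KR nT (h b)"
    and "0 \<le> \<mu>" and "\<mu> \<le> 1" and "r \<ge> 0"
    and "delta_star_P KT KR nT N h \<mu> r \<noteq> \<infinity>"
  shows "delta_p_ach KT KR nT \<mu> r / delta_star_P KT KR nT N h \<mu> r \<le> 2"
proof -
  let ?ach = "delta_p_ach KT KR nT \<mu> r" and ?star = "delta_star_P KT KR nT N h \<mu> r"
  let ?inf = "INF T\<in>feasible_times KT KR nT r \<mu>. ereal T"
  have inf: "?inf \<le> ?star"
    using assms by (intro delta_star_P_ge)
  have "1 \<le> ?inf"
    by (rule INF_greatest) (auto simp: feasible_times_def)
  with inf have "1 \<le> ?star" by (rule order_trans[rotated])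
  \<comment> \<open>Positivity, together with the assumed finiteness, allows the extended-real
    quotient to be cleared at the end.\<close>
  then have pos: "0 < ?star" by (rule less_le_trans[rotated]) simp
  have "?ach / 2 \<le> ereal T" if "T \<in> feasible_times KT KR nT r \<mu>" for T
    using delta_p_ach_le_feasible[OF assms(1-3,6-8) that]
    by (subst ereal_divide_le_pos) auto
  then have "?ach / 2 \<le> ?inf" by (rule INF_greatest)
  with inf have "?ach / 2 \<le> ?star" by (rule order_trans[rotated])
  then have "?ach \<le> 2 * ?star" by (subst (asm) ereal_divide_le_pos) auto
  then show ?thesis
    using pos assms(9) by (subst ereal_divide_le_pos) (auto simp: mult.commute)
qed

end
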